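(* (The Truncation Theorem.) Let $\mathcal{P}$ be an arbitrary single-arm policy executing over the state space $\mathcal{S}$ defined by i.i.d. draws from a reward distribution $D(\theta)$, where a prior distribution $\mathcal{D}$ is specified over the unknown parameter $\theta$. Suppose $\mathbb{E}[D(\theta)]\ge 0$ for all parameter values $\theta$. Let $\beta\in[0,1]$ and let $\mathcal{P}'$ be a policy that executes the decisions of $\mathcal{P}$ but stops after having made (at least) a $\beta$ fraction of the plays that $\mathcal{P}$ makes on that decision path, on every decision path of $\mathcal{P}$. Then (i) $R(\mathcal{P}')\ge \beta R(\mathcal{P})$ and (ii) $\mathcal{T}(\mathcal{P}')\le \mathcal{T}(\mathcal{P})$.
   Context: Bayesian bandit arm: an arm yields i.i.d. rewards from a distribution $D(\theta)$ with unknown parameter $\theta$ drawn from a prior $\mathcal{D}$. After observing a multiset $\sigma$ of rewards the prior is updated by Bayes' rule; each possible set of observations is a state of the arm, and $\mathcal{S}$ is the resulting state space. A single-arm policy is a (possibly randomized) rule which, depending on the current state (and remaining time), either plays the arm (observing a reward and moving to the updated state) or stops. A decision path of a policy is the sequence of (observed reward, action) pairs encountered by the policy until it stops. $R(\mathcal{P})$ denotes the expected total reward of $\mathcal{P}$ and $\mathcal{T}(\mathcal{P})$ the expected number of plays it makes, expectations over the prior, all outcomes and the policy's randomization.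
   Formalization: The policy's rewards are assumed absolutely summable in expectation; without this the claim fails for unbounded policies (a symmetric ±1 walk stopped on reaching −1 has expected reward −1, so it violates (i) for β < 1). *)

theory Defs
  imports "HOL-Probability.Probability"
begin

text \<open>
  The parameter ranges over the space of the measure \<open>prior\<close>, and \<open>D \<theta>\<close> is the reward
  distribution under \<open>\<theta>\<close>. \<open>reward_law\<close> is the law of the whole reward sequence with \<open>\<theta>\<close>
  integrated out: draw \<open>\<theta>\<close> from the prior, then draw the rewards of successive plays
  i.i.d. from \<open>D \<theta>\<close>. The conditional law of the next reward given the observations so far
  is the posterior predictive law, so the Bayesian updates are implicit in it.
\<close>

definition bayesian_arm :: "'p measure \<Rightarrow> ('p \<Rightarrow> real measure) \<Rightarrow> bool" where
  "bayesian_arm prior D \<longleftrightarrow> prob_space prior \<and> D \<in> prior \<rightarrow>\<^sub>M prob_algebra borel"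

definition reward_law :: "'p measure \<Rightarrow> ('p \<Rightarrow> real measure) \<Rightarrow> (nat \<Rightarrow> real) measure" where
  "reward_law prior D = prior \<bind> (\<lambda>\<theta>. \<Pi>\<^sub>M t\<in>UNIV. D \<theta>)"

text \<open>
  A randomized rule is a family of deterministic rules indexed by a random seed \<open>w\<close>, drawn
  from \<open>W\<close> independently of the parameter and of the rewards. A rule that plays in state \<open>s\<close>
  with probability \<open>p s\<close> is the instance where \<open>w\<close> is a sequence of independent uniform
  variables on the unit interval and the rule plays iff \<open>w (size s) < p s\<close>.
\<close>

definition arm_space ::
  "'w measure \<Rightarrow> 'p measure \<Rightarrow> ('p \<Rightarrow> real measure) \<Rightarrow> ('w \<times> (nat \<Rightarrow> real)) measure" where
  "arm_space W prior D = W \<Otimes>\<^sub>M reward_law prior D"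

definition history :: "(nat \<Rightarrow> real) \<Rightarrow> nat \<Rightarrow> real list" where
  "history x t = map x [0..<t]"

text \<open>
  \<open>True\<close> means play, \<open>False\<close> means stop. Since stopping is final, every action but the last on
  a decision path is to play, so the list of observed rewards determines the path up to the
  current decision.
\<close>

type_synonym 'w path_rule = "'w \<Rightarrow> real list \<Rightarrow> bool"

definition policy :: "'w measure \<Rightarrow> 'w path_rule \<Rightarrow> bool" where
  "policy W Q \<longleftrightarrow>
     (\<forall>t. Measurable.pred (W \<Otimes>\<^sub>M (\<Pi>\<^sub>M i\<in>UNIV. borel)) (\<lambda>(w, x). Q w (history x t)))"

text \<open>
  The states of the arm are the multisets of observed rewards. The size of the state is the
  number of plays made so far, hence a dependence on the remaining time is a dependence on
  the state.
\<close>

type_synonym 'w state_rule = "'w \<Rightarrow> real multiset \<Rightarrow> bool"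

definition on_states :: "'w state_rule \<Rightarrow> 'w path_rule" where
  "on_states P = (\<lambda>w h. P w (mset h))"

definition plays :: "'w path_rule \<Rightarrow> 'w \<Rightarrow> (nat \<Rightarrow> real) \<Rightarrow> enat" where
  "plays Q w x = (INF t\<in>{t. \<not> Q w (history x t)}. enat t)"

definition total_reward :: "'w path_rule \<Rightarrow> 'w \<Rightarrow> (nat \<Rightarrow> real) \<Rightarrow> real" where
  "total_reward Q w x = (\<Sum>t. if enat t < plays Q w x then x t else 0)"

definition expected_reward ::
  "'w measure \<Rightarrow> 'p measure \<Rightarrow> ('p \<Rightarrow> real measure) \<Rightarrow> 'w path_rule \<Rightarrow> real" where
  "expected_reward W prior D Q = (\<integral>(w, x). total_reward Q w x \<partial>arm_space W prior D)"

definition expected_plays ::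
  "'w measure \<Rightarrow> 'p measure \<Rightarrow> ('p \<Rightarrow> real measure) \<Rightarrow> 'w path_rule \<Rightarrow> ennreal" where
  "expected_plays W prior D Q =
     (\<integral>\<^sup>+ (w, x). ennreal_of_enat (plays Q w x) \<partial>arm_space W prior D)"

text \<open>
  The expected total reward is only meaningful for policies whose rewards are absolutely
  summable in expectation. This holds for every policy with a bounded number of plays if the
  expected absolute reward of one play under the prior is finite. Integrability of
  \<open>total_reward\<close> alone is too weak when plays are unbounded: a symmetric random walk stopped
  on reaching \<open>-1\<close> has zero mean steps but expected total \<open>-1\<close>.
\<close>

definition absolutely_summable_reward ::
  "'w measure \<Rightarrow> 'p measure \<Rightarrow> ('p \<Rightarrow> real measure) \<Rightarrow> 'w path_rule \<Rightarrow> bool" where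
  "absolutely_summable_reward W prior D Q \<longleftrightarrow>
     (\<integral>\<^sup>+ (w, x). (\<Sum>t. if enat t < plays Q w x then ennreal \<bar>x t\<bar> else 0)
        \<partial>arm_space W prior D) < \<infinity>"

text \<open>
  \<open>Q'\<close> runs on the same seed and the same rewards as \<open>Q\<close>, plays only where \<open>Q\<close> plays, and
  stops no earlier than after a fraction \<open>\<beta>\<close> of the plays that \<open>Q\<close> makes on that path. Each
  decision of \<open>Q'\<close> sees only the rewards observed so far, so it cannot anticipate later ones.
\<close>

definition truncation ::
  "'w measure \<Rightarrow> 'p measure \<Rightarrow> ('p \<Rightarrow> real measure) \<Rightarrow> real \<Rightarrow> 'w path_rule \<Rightarrow> 'w path_rule \<Rightarrow> bool"
where
  "truncation W prior D \<beta> Q Q' \<longleftrightarrow>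
     (AE (w, x) in arm_space W prior D.
        (\<forall>t. enat t < plays Q' w x \<longrightarrow> Q w (history x t)) \<and>
        ennreal \<beta> * ennreal_of_enat (plays Q w x) \<le> ennreal_of_enat (plays Q' w x))"

end

theory Submission
  imports Defs
begin

text \<open>
  Fix the seed \<open>w\<close> and the parameter \<open>\<theta>\<close>. Whether the \<open>t\<close>-th play is made depends only on the
  earlier rewards, so it is independent of the \<open>t\<close>-th reward, and the expected total reward is
  the mean of \<open>D \<theta>\<close> times the expected number of plays (Wald's identity). A truncated policy
  makes, given \<open>w\<close> and \<open>\<theta>\<close>, at least \<open>\<beta>\<close> times the expected number of plays. Since the mean
  is nonnegative, the inequality between rewards holds given \<open>w\<close> and \<open>\<theta>\<close>, and it remains to
  integrate. Everything is done in \<open>ennreal\<close>, separately for positive and negative rewards.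
\<close>

section \<open>Laws of i.i.d. sequences\<close>

text \<open>Cylinder sets are closed under intersection and generate the product \<sigma>-algebra,
  so measurability in \<theta> need only be checked on them. There the product measure is a finite
  product of the measurable maps \<open>emeasure (D \<theta>) (E j)\<close>. This lets the parameter
  be integrated out in \<open>reward_law\<close>.\<close>

lemma measurable_PiM_prob_algebra:
  assumes D: "D \<in> M \<rightarrow>\<^sub>M prob_algebra N"
  shows "(\<lambda>\<theta>. \<Pi>\<^sub>M t\<in>I. D \<theta>) \<in> M \<rightarrow>\<^sub>M prob_algebra (\<Pi>\<^sub>M t\<in>I. N)"
proof (rule measurable_prob_algebra_generated[OF sets_PiM Int_stable_prod_algebra prod_algebra_sets_into_space])
  have prob: "prob_space (D \<theta>)" and sets: "sets (D \<theta>) = sets N" if "\<theta> \<in> space M" for \<theta>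
    using measurable_space[OF D that] by (auto simp: space_prob_algebra)
  show "prob_space (\<Pi>\<^sub>M t\<in>I. D \<theta>)" "sets (\<Pi>\<^sub>M t\<in>I. D \<theta>) = sets (\<Pi>\<^sub>M t\<in>I. N)" if "\<theta> \<in> space M" for \<theta>
    using that by (auto intro!: prob_space_PiM prob sets_PiM_cong sets)
  fix A assume "A \<in> prod_algebra I (\<lambda>_. N)"
  then obtain J E where J: "A = prod_emb I (\<lambda>_. N) J (\<Pi>\<^sub>E j\<in>J. E j)" "finite J" "J \<subseteq> I"
    and E[measurable]: "\<And>j. j \<in> J \<Longrightarrow> E j \<in> sets N"
    by (auto elim!: prod_algebraE)
  have "emeasure (\<Pi>\<^sub>M t\<in>I. D \<theta>) A = (\<Prod>j\<in>J. emeasure (D \<theta>) (E j))" if \<theta>: "\<theta> \<in> space M" for \<theta>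
  proof -
    \<comment> \<open>\<open>prod_emb\<close> depends only on the underlying spaces, so the cylinder
      over \<open>N\<close> is also one over \<open>D \<theta>\<close>.\<close>
    have "A = prod_emb I (\<lambda>_. D \<theta>) J (\<Pi>\<^sub>E j\<in>J. E j)"
      using sets_eq_imp_space_eq[OF sets[OF \<theta>]] by (simp add: J prod_emb_def)
    then show ?thesis
      using J E by (simp add: emeasure_PiM_emb prob[OF \<theta>] sets[OF \<theta>])
  qed
  moreover have "(\<lambda>\<theta>. \<Prod>j\<in>J. emeasure (D \<theta>) (E j)) \<in> borel_measurable M"
    by (intro borel_measurable_prod_ennreal
        measurable_compose[OF measurable_prob_algebraD[OF D] measurable_emeasure_subprob_algebra] E)
  ultimately show "(\<lambda>\<theta>. emeasure (\<Pi>\<^sub>M t\<in>I. D \<theta>) A) \<in> borel_measurable M"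
    by (simp cong: measurable_cong)
qed

text \<open>
  Splitting the sequence into its first \<open>t\<close> entries and an independent copy of itself makes a
  function of the past independent of the \<open>t\<close>-th entry.
\<close>

lemma nn_integral_PiM_past_times_present:
  fixes M :: "'a measure" and g :: "'a \<Rightarrow> ennreal" and h :: "(nat \<Rightarrow> 'a) \<Rightarrow> ennreal"
  assumes "prob_space M"
    and [measurable]: "g \<in> borel_measurable M" "h \<in> borel_measurable (\<Pi>\<^sub>M i\<in>UNIV. M)"
    and past: "\<And>x y. (\<And>i. i < t \<Longrightarrow> x i = y i) \<Longrightarrow> h x = h y"
  shows "(\<integral>\<^sup>+x. h x * g (x t) \<partial>(\<Pi>\<^sub>M i\<in>UNIV. M)) = (\<integral>\<^sup>+x. h x \<partial>(\<Pi>\<^sub>M i\<in>UNIV. M)) * (\<integral>\<^sup>+r. g r \<partial>M)"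
proof -
  interpret prob_space M by fact
  interpret sequence_space M ..
  have h: "h (comb_seq t x y) = h x" for x y
    by (rule past) (simp add: comb_seq_less)
  \<comment> \<open>Indices below \<open>t\<close> are taken from \<open>x\<close>, so index
    \<open>t\<close> is the first one taken from the independent copy \<open>y\<close>.\<close>
  have [simp]: "comb_seq t x y t = y 0" for x y :: "nat \<Rightarrow> 'a"
    using comb_seq_add[of t x y 0] by simp
  have "(\<integral>\<^sup>+x. h x * g (x t) \<partial>S) = (\<integral>\<^sup>+x. h x * g (x t) \<partial>distr (S \<Otimes>\<^sub>M S) S (\<lambda>(x, y). comb_seq t x y))"
    by (simp add: PiM_comb_seq)
  also have "\<dots> = (\<integral>\<^sup>+z. h (fst z) * g (snd z 0) \<partial>(S \<Otimes>\<^sub>M S))"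
    by (subst nn_integral_distr) (auto simp: h split_beta intro!: nn_integral_cong)
  also have "\<dots> = (\<integral>\<^sup>+x. \<integral>\<^sup>+y. h x * g (y 0) \<partial>S \<partial>S)"
    by (subst P.nn_integral_fst[symmetric]) auto
  also have "\<dots> = (\<integral>\<^sup>+x. h x \<partial>S) * (\<integral>\<^sup>+y. g (y 0) \<partial>S)"
    by (simp add: nn_integral_cmult nn_integral_multc)
  also have "(\<integral>\<^sup>+y. g (y 0) \<partial>S) = (\<integral>\<^sup>+r. g r \<partial>distr S M (\<lambda>y. y 0))"
    by (rule nn_integral_distr[symmetric]) auto
  also have "distr S M (\<lambda>y. y 0) = M"
    by (rule PiM_component) auto
  finally show ?thesis .
qed

section \<open>Counting plays\<close>

lemma less_plays_iff: "enat t < plays Q w x \<longleftrightarrow> (\<forall>s\<le>t. Q w (history x s))"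
proof -
  \<comment> \<open>A strict bound below an infimum does not pass to its members in both directions;
    the equivalent bound by \<open>Suc t\<close> does, also when the infimum is infinite.\<close>
  have "enat t < plays Q w x \<longleftrightarrow> enat (Suc t) \<le> plays Q w x"
    by (metis Suc_ile_eq)
  also have "\<dots> \<longleftrightarrow> (\<forall>s. \<not> Q w (history x s) \<longrightarrow> Suc t \<le> s)"
    by (auto simp: plays_def le_INF_iff)
  also have "\<dots> \<longleftrightarrow> (\<forall>s\<le>t. Q w (history x s))"
    using not_less_eq_eq by blast
  finally show ?thesis .
qed

text \<open>Play \<open>t\<close> is decided before reward \<open>t\<close> is seen: the histories
  up to time \<open>t\<close> contain only rewards with index below \<open>t\<close>. This is the
  non-anticipation that independence requires.\<close>

lemma less_plays_cong:
  assumes "\<And>i. i < t \<Longrightarrow> x i = y i"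
  shows "enat t < plays Q w x \<longleftrightarrow> enat t < plays Q w y"
proof -
  have "history x s = history y s" if "s \<le> t" for s
    using assms that by (auto simp: history_def)
  then show ?thesis
    by (auto simp: less_plays_iff)
qed

lemma pred_less_plays:
  assumes "policy W Q"
  shows "Measurable.pred (W \<Otimes>\<^sub>M (\<Pi>\<^sub>M i\<in>UNIV. borel)) (\<lambda>z. enat t < plays Q (fst z) (snd z))"
proof -
  have [measurable]: "Measurable.pred (W \<Otimes>\<^sub>M (\<Pi>\<^sub>M i\<in>UNIV. borel)) (\<lambda>z. Q (fst z) (history (snd z) s))" for s
    using assms by (simp add: policy_def split_beta')
  show ?thesis
    unfolding less_plays_iff by measurable
qed

text \<open>Makes the number of plays a cumulative reward with reward 1 for each play.\<close>

lemma ennreal_of_enat_eq_suminf: "ennreal_of_enat n = (\<Sum>t. if enat t < n then 1 else 0)"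
proof (cases n)
  case (enat k)
  have "(\<lambda>t. if t < k then 1 else 0 :: ennreal) sums (\<Sum>t<k. 1)"
    by (rule sums_If_finite_set[of "{..<k}" "\<lambda>_. 1", simplified])
  then show ?thesis
    by (simp add: enat sums_iff)
next
  case infinity
  have "(\<lambda>_. 1 :: ennreal) sums \<top>"
    unfolding sums_def using of_nat_tendsto_top_ennreal by simp
  then show ?thesis
    by (simp add: infinity sums_iff)
qed

section \<open>Splitting series and integrals into nonnegative parts\<close>

text \<open>A series is an integral over the counting measure and absolute summability is
  integrability there, so the splitting of the Lebesgue integral applies.\<close>

lemma suminf_eq_positive_minus_negative:
  fixes f :: "nat \<Rightarrow> real"
  assumes "(\<Sum>t. ennreal \<bar>f t\<bar>) < \<infinity>"
  shows "(\<Sum>t. f t) = enn2real (\<Sum>t. ennreal (f t)) - enn2real (\<Sum>t. ennreal (- f t))"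
proof -
  have int: "integrable (count_space UNIV) f"
    using assms by (simp add: integrable_iff_bounded nn_integral_count_space_nat)
  then show ?thesis
    using real_lebesgue_integral_def[OF int] integral_count_space_nat[OF int]
    by (simp add: nn_integral_count_space_nat)
qed

text \<open>Here \<open>p\<close> and \<open>n\<close> may both be positive at the same point, as
  happens when a path has rewards of both signs.\<close>

lemma integral_eq_positive_minus_negative:
  fixes M :: "'a measure" and f :: "'a \<Rightarrow> real"
  assumes [measurable]: "p \<in> borel_measurable M" "n \<in> borel_measurable M"
    and fin: "(\<integral>\<^sup>+z. p z \<partial>M) < \<infinity>" "(\<integral>\<^sup>+z. n z \<partial>M) < \<infinity>"
    and f: "AE z in M. f z = enn2real (p z) - enn2real (n z)"
    and f_measurable: "f \<in> borel_measurable M"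
  shows "(\<integral>z. f z \<partial>M) = enn2real (\<integral>\<^sup>+z. p z \<partial>M) - enn2real (\<integral>\<^sup>+z. n z \<partial>M)"
proof -
  have part: "integrable M (\<lambda>z. enn2real (q z))"
    "(\<integral>z. enn2real (q z) \<partial>M) = enn2real (\<integral>\<^sup>+z. q z \<partial>M)"
    if [measurable]: "q \<in> borel_measurable M" and q: "(\<integral>\<^sup>+z. q z \<partial>M) < \<infinity>" for q
  proof -
    \<comment> \<open>\<open>enn2real\<close> sends infinity to 0; a finite integral confines this
      to a null set.\<close>
    have "AE z in M. q z \<noteq> \<infinity>"
      using q by (intro nn_integral_noteq_infinite) auto
    then have "(\<integral>\<^sup>+z. ennreal (enn2real (q z)) \<partial>M) = (\<integral>\<^sup>+z. q z \<partial>M)"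
      by (intro nn_integral_cong_AE) (auto simp: less_top)
    with q show "integrable M (\<lambda>z. enn2real (q z))"
      "(\<integral>z. enn2real (q z) \<partial>M) = enn2real (\<integral>\<^sup>+z. q z \<partial>M)"
      by (auto simp: integrable_iff_bounded integral_eq_nn_integral)
  qed
  have "(\<integral>z. f z \<partial>M) = (\<integral>z. enn2real (p z) - enn2real (n z) \<partial>M)"
    by (rule integral_cong_AE) (auto simp: f f_measurable)
  then show ?thesis
    using part[of p] part[of n] fin by simp
qed

section \<open>Disintegration over seed and parameter\<close>

locale seeded_arm =
  fixes W :: "'w measure" and prior :: "'p measure" and D :: "'p \<Rightarrow> real measure"
  assumes prob_W: "prob_space W" and arm: "bayesian_arm prior D"
begin

sublocale W: prob_space W
  by (rule prob_W)

sublocale prior: prob_space prior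
  using arm by (simp add: bayesian_arm_def)

abbreviation Env :: "('w \<times> 'p) measure" where
  "Env \<equiv> W \<Otimes>\<^sub>M prior"

abbreviation Paths :: "('w \<times> (nat \<Rightarrow> real)) measure" where
  "Paths \<equiv> W \<Otimes>\<^sub>M (\<Pi>\<^sub>M t\<in>UNIV. borel)"

abbreviation rewards :: "'p \<Rightarrow> (nat \<Rightarrow> real) measure" where
  "rewards \<theta> \<equiv> \<Pi>\<^sub>M t\<in>UNIV. D \<theta>"

abbreviation outcomes :: "('w \<times> (nat \<Rightarrow> real)) measure" where
  "outcomes \<equiv> arm_space W prior D"

lemma measurable_D: "D \<in> prior \<rightarrow>\<^sub>M prob_algebra borel"
  using arm by (simp add: bayesian_arm_def)

lemma prob_space_D: "\<theta> \<in> space prior \<Longrightarrow> prob_space (D \<theta>)"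
  and sets_D: "\<theta> \<in> space prior \<Longrightarrow> sets (D \<theta>) = sets borel"
  using measurable_space[OF measurable_D] by (auto simp: space_prob_algebra)

lemma measurable_rewards[measurable]: "rewards \<in> prior \<rightarrow>\<^sub>M subprob_algebra (\<Pi>\<^sub>M t\<in>UNIV. borel)"
  by (intro measurable_prob_algebraD measurable_PiM_prob_algebra measurable_D)

lemma measurable_D_subprob[measurable]: "D \<in> prior \<rightarrow>\<^sub>M subprob_algebra borel"
  by (intro measurable_prob_algebraD measurable_D)

lemma sets_reward_law: "sets (reward_law prior D) = sets (\<Pi>\<^sub>M t\<in>UNIV. borel)"
  unfolding reward_law_def
  by (rule sets_bind_measurable[OF measurable_rewards prior.not_empty])

lemma sets_outcomes[measurable_cong]: "sets outcomes = sets Paths"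
  unfolding arm_space_def by (intro sets_pair_measure_cong refl sets_reward_law)

lemma prob_space_reward_law: "prob_space (reward_law prior D)"
  unfolding reward_law_def
  by (rule prior.prob_space_bind[OF AE_I2 measurable_rewards]) (auto intro: prob_space_PiM prob_space_D)

lemma measurable_nn_integral_rewards:
  assumes "f \<in> borel_measurable Paths"
  shows "(\<lambda>(w, \<theta>). \<integral>\<^sup>+x. f (w, x) \<partial>rewards \<theta>) \<in> borel_measurable Env"
proof -
  note [measurable] = assms
  have "(\<lambda>z. \<integral>\<^sup>+x. f (fst z, x) \<partial>rewards (snd z)) \<in> borel_measurable Env"
    by (rule nn_integral_measurable_subprob_algebra2[where N="\<Pi>\<^sub>M t\<in>UNIV. borel"]) measurable
  then show ?thesis
    by (simp add: split_beta')
qed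

text \<open>Tonelli separates the seed from the rewards, and integrating against a
  \<open>bind\<close> is iterated integration. Later estimates can thus be made given the seed and
  \<theta>, where rewards are i.i.d.\<close>

lemma nn_integral_outcomes:
  assumes "f \<in> borel_measurable Paths"
  shows "(\<integral>\<^sup>+z. f z \<partial>outcomes) = (\<integral>\<^sup>+(w, \<theta>). (\<integral>\<^sup>+x. f (w, x) \<partial>rewards \<theta>) \<partial>Env)"
proof -
  interpret law: prob_space "reward_law prior D"
    by (rule prob_space_reward_law)
  have [measurable]: "f \<in> borel_measurable (W \<Otimes>\<^sub>M reward_law prior D)"
    using assms sets_outcomes by (simp add: arm_space_def cong: measurable_cong_sets)
  have "(\<integral>\<^sup>+z. f z \<partial>outcomes) = (\<integral>\<^sup>+w. \<integral>\<^sup>+x. f (w, x) \<partial>reward_law prior D \<partial>W)"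
    unfolding arm_space_def by (rule law.nn_integral_fst[symmetric]) measurable
  also have "\<dots> = (\<integral>\<^sup>+w. \<integral>\<^sup>+\<theta>. \<integral>\<^sup>+x. f (w, x) \<partial>rewards \<theta> \<partial>prior \<partial>W)"
    unfolding reward_law_def using assms
    by (intro nn_integral_cong nn_integral_bind[OF _ measurable_rewards] measurable_compose_Pair1)
  also have "\<dots> = (\<integral>\<^sup>+(w, \<theta>). (\<integral>\<^sup>+x. f (w, x) \<partial>rewards \<theta>) \<partial>Env)"
    using prior.nn_integral_fst[OF measurable_nn_integral_rewards[OF assms]] by simp
  finally show ?thesis .
qed

text \<open>The exceptions lie in a measurable null set \<open>N\<close>. The integral of its
  indicator vanishes, so by disintegration almost all sections of \<open>N\<close> are null.\<close>

lemma AE_outcomes_D: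
  assumes "AE z in outcomes. Q z"
  shows "AE (w, \<theta>) in Env. AE x in rewards \<theta>. Q (w, x)"
proof -
  obtain N where N: "{z \<in> space outcomes. \<not> Q z} \<subseteq> N" "emeasure outcomes N = 0" "N \<in> sets outcomes"
    using assms by (rule AE_E)
  then have [measurable]: "N \<in> sets Paths"
    by (simp add: sets_outcomes)
  have "0 = (\<integral>\<^sup>+z. indicator N z \<partial>outcomes)"
    using N by simp
  also have "\<dots> = (\<integral>\<^sup>+(w, \<theta>). (\<integral>\<^sup>+x. indicator N (w, x) \<partial>rewards \<theta>) \<partial>Env)"
    by (rule nn_integral_outcomes) measurable
  finally have "AE (w, \<theta>) in Env. (\<integral>\<^sup>+x. indicator N (w, x) \<partial>rewards \<theta>) = (0::ennreal)"
    using nn_integral_0_iff_AE[OF measurable_nn_integral_rewards[of "indicator N"]]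
    by (simp add: split_beta')
  then show ?thesis
  proof (rule AE_mp, intro AE_I2, clarsimp simp: space_pair_measure)
    fix w \<theta> assume w: "w \<in> space W" and \<theta>: "\<theta> \<in> space prior"
      and zero: "(\<integral>\<^sup>+x. indicator N (w, x) \<partial>rewards \<theta>) = (0::ennreal)"
    have sets: "sets (rewards \<theta>) = sets (\<Pi>\<^sub>M t\<in>UNIV. borel)"
      by (intro sets_PiM_cong refl sets_D \<theta>)
    have "(\<lambda>x. indicator N (w, x) :: ennreal) \<in> borel_measurable (\<Pi>\<^sub>M t\<in>UNIV. borel)"
      using w by measurable
    then have "AE x in rewards \<theta>. indicator N (w, x) = (0::ennreal)"
      using nn_integral_0_iff_AE[of "\<lambda>x. indicator N (w, x)" "rewards \<theta>"] zero
      by (simp add: measurable_cong_sets[OF sets refl])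
    then show "AE x in rewards \<theta>. Q (w, x)"
    proof (rule AE_mp, intro AE_I2 impI)
      fix x assume "x \<in> space (rewards \<theta>)" and "indicator N (w, x) = (0::ennreal)"
      moreover from this have "(w, x) \<in> space outcomes"
        using w sets_eq_imp_space_eq[OF sets] sets_eq_imp_space_eq[OF sets_outcomes]
        by (simp add: space_pair_measure)
      ultimately show "Q (w, x)"
        using N(1) by (auto simp: indicator_eq_0_iff)
    qed
  qed
qed

section \<open>Wald's identity and the mean reward of a play\<close>

text \<open>The choice of \<open>g\<close> covers all quantities needed: 1 counts plays,
  \<open>ennreal r\<close> and \<open>ennreal (- r)\<close> collect gains and losses
  (\<open>ennreal\<close> cuts off at 0), and the absolute value expresses summability.\<close>

definition cumulative :: "(real \<Rightarrow> ennreal) \<Rightarrow> 'w path_rule \<Rightarrow> 'w \<times> (nat \<Rightarrow> real) \<Rightarrow> ennreal" where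
  "cumulative g Q z = (\<Sum>t. if enat t < plays Q (fst z) (snd z) then g (snd z t) else 0)"

definition mean_plays :: "'w path_rule \<Rightarrow> 'w \<times> 'p \<Rightarrow> ennreal" where
  "mean_plays Q = (\<lambda>(w, \<theta>). \<integral>\<^sup>+x. ennreal_of_enat (plays Q w x) \<partial>rewards \<theta>)"

lemma measurable_cumulative:
  assumes "policy W Q" and [measurable]: "g \<in> borel_measurable borel"
  shows "cumulative g Q \<in> borel_measurable Paths"
proof -
  note [measurable] = pred_less_plays[OF assms(1)]
  show ?thesis
    unfolding cumulative_def[abs_def] by measurable
qed

lemma plays_eq_cumulative: "ennreal_of_enat (plays Q w x) = cumulative (\<lambda>_. 1) Q (w, x)"
  by (simp add: ennreal_of_enat_eq_suminf cumulative_def)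

lemma measurable_mean_plays: "policy W Q \<Longrightarrow> mean_plays Q \<in> borel_measurable Env"
  unfolding mean_plays_def plays_eq_cumulative
  by (intro measurable_nn_integral_rewards measurable_cumulative) auto

text \<open>The event that play \<open>t\<close> is made depends on rewards before \<open>t\<close>
  only, so each term of the series factors into the probability of that event and the mean of
  \<open>g\<close>. Nonnegativity allows exchanging sum and integral even for infinite
  values.\<close>

lemma conditional_wald:
  assumes Q: "policy W Q" and g[measurable]: "g \<in> borel_measurable borel"
    and w: "w \<in> space W" and \<theta>: "\<theta> \<in> space prior"
  shows "(\<integral>\<^sup>+x. cumulative g Q (w, x) \<partial>rewards \<theta>) = (\<integral>\<^sup>+r. g r \<partial>D \<theta>) * mean_plays Q (w, \<theta>)"
proof -
  have [measurable_cong]: "sets (D \<theta>) = sets borel"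
    by (rule sets_D[OF \<theta>])
  have [measurable_cong]: "sets (rewards \<theta>) = sets (\<Pi>\<^sub>M t\<in>UNIV. borel)"
    by (intro sets_PiM_cong refl sets_D \<theta>)
  \<comment> \<open>As a 0-1 factor the condition gives the summands the product form to which
    independence applies.\<close>
  define alive where "alive = (\<lambda>t x. if enat t < plays Q w x then 1 else 0 :: ennreal)"
  have "Measurable.pred (\<Pi>\<^sub>M t\<in>UNIV. borel) (\<lambda>x. enat t < plays Q w x)" for t
    using measurable_compose_Pair1[OF w pred_less_plays[OF Q]] by simp
  then have alive[measurable]: "alive t \<in> borel_measurable (rewards \<theta>)" for t
    unfolding alive_def by measurable
  have "(\<integral>\<^sup>+x. cumulative g Q (w, x) \<partial>rewards \<theta>) = (\<integral>\<^sup>+x. (\<Sum>t. alive t x * g (x t)) \<partial>rewards \<theta>)"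
    by (auto simp: cumulative_def alive_def intro!: nn_integral_cong suminf_cong)
  also have "\<dots> = (\<Sum>t. \<integral>\<^sup>+x. alive t x * g (x t) \<partial>rewards \<theta>)"
    by (rule nn_integral_suminf) measurable
  also have "\<dots> = (\<Sum>t. (\<integral>\<^sup>+x. alive t x \<partial>rewards \<theta>) * (\<integral>\<^sup>+r. g r \<partial>D \<theta>))"
  proof (intro suminf_cong nn_integral_PiM_past_times_present)
    show "alive t x = alive t y" if "\<And>i. i < t \<Longrightarrow> x i = y i" for t x y
      using less_plays_cong[of t x y Q w, OF that] by (simp add: alive_def)
  qed (auto simp: prob_space_D[OF \<theta>] measurable_cong_sets[OF sets_D[OF \<theta>] refl])
  also have "\<dots> = (\<integral>\<^sup>+x. (\<Sum>t. alive t x) \<partial>rewards \<theta>) * (\<integral>\<^sup>+r. g r \<partial>D \<theta>)"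
    by (simp add: nn_integral_suminf)
  finally show ?thesis
    by (simp add: mean_plays_def alive_def ennreal_of_enat_eq_suminf mult.commute)
qed

lemma nn_integral_cumulative:
  assumes "policy W Q" and "g \<in> borel_measurable borel"
  shows "(\<integral>\<^sup>+z. cumulative g Q z \<partial>outcomes) = (\<integral>\<^sup>+z. (\<integral>\<^sup>+r. g r \<partial>D (snd z)) * mean_plays Q z \<partial>Env)"
  unfolding nn_integral_outcomes[OF measurable_cumulative[OF assms]]
  by (intro nn_integral_cong) (auto simp: conditional_wald[OF assms] space_pair_measure)

text \<open>
  The difference in \<open>ennreal\<close> is truncated at 0, so this is the mean reward of one play only if
  that mean is nonnegative.
\<close>

definition mean_reward :: "'p \<Rightarrow> ennreal" where
  "mean_reward \<theta> = (\<integral>\<^sup>+r. ennreal r \<partial>D \<theta>) - (\<integral>\<^sup>+r. ennreal (- r) \<partial>D \<theta>)"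

lemma measurable_mean_reward[measurable]: "mean_reward \<in> borel_measurable prior"
proof -
  have "(\<lambda>\<theta>. \<integral>\<^sup>+r. g r \<partial>D \<theta>) \<in> borel_measurable prior" if "g \<in> borel_measurable borel" for g
    using that
    by (rule measurable_compose[OF measurable_D_subprob nn_integral_measurable_subprob_algebra])
  then show ?thesis
    unfolding mean_reward_def[abs_def] by simp
qed

text \<open>A nonnegative mean puts the negative part below the positive part, so the subtraction in
  \<open>mean_reward\<close> is not cut off and can be undone. This is where the sign of the mean
  enters.\<close>

lemma mean_reward_add_negative:
  assumes int: "integrable (D \<theta>) (\<lambda>r. r)" and nonneg: "0 \<le> (\<integral>r. r \<partial>D \<theta>)"
  shows "(\<integral>\<^sup>+r. ennreal r \<partial>D \<theta>) = mean_reward \<theta> + (\<integral>\<^sup>+r. ennreal (- r) \<partial>D \<theta>)"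
proof -
  have fin: "(\<integral>\<^sup>+r. ennreal r \<partial>D \<theta>) < \<top>" "(\<integral>\<^sup>+r. ennreal (- r) \<partial>D \<theta>) < \<top>"
    using int by (auto simp: real_integrable_def less_top)
  have "enn2real (\<integral>\<^sup>+r. ennreal (- r) \<partial>D \<theta>) \<le> enn2real (\<integral>\<^sup>+r. ennreal r \<partial>D \<theta>)"
    using nonneg real_lebesgue_integral_def[OF int] by simp
  then have "(\<integral>\<^sup>+r. ennreal (- r) \<partial>D \<theta>) \<le> (\<integral>\<^sup>+r. ennreal r \<partial>D \<theta>)"
    using fin by (metis ennreal_enn2real ennreal_leI)
  then show ?thesis
    by (simp add: mean_reward_def diff_add_cancel_ennreal)
qed

section \<open>Expected reward as an integral over seed and parameter\<close>

text \<open>The expected reward is expected gains minus expected losses. By Wald's identity the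
  gains are the claimed integral plus the losses; the losses are finite and cancel.\<close>

lemma expected_reward_eq:
  assumes nice: "\<And>\<theta>. \<theta> \<in> space prior \<Longrightarrow> integrable (D \<theta>) (\<lambda>r. r)"
      "\<And>\<theta>. \<theta> \<in> space prior \<Longrightarrow> 0 \<le> (\<integral>r. r \<partial>D \<theta>)"
    and Q: "policy W Q" and summable: "absolutely_summable_reward W prior D Q"
  shows "(\<integral>\<^sup>+z. mean_reward (snd z) * mean_plays Q z \<partial>Env) < \<infinity>"
    and "expected_reward W prior D Q = enn2real (\<integral>\<^sup>+z. mean_reward (snd z) * mean_plays Q z \<partial>Env)"
proof -
  note [measurable] = measurable_mean_plays[OF Q] pred_less_plays[OF Q]
  let ?abs = "cumulative (\<lambda>r. ennreal \<bar>r\<bar>) Q" and ?pos = "cumulative ennreal Q"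
    and ?neg = "cumulative (\<lambda>r. ennreal (- r)) Q"
  have cumulative[measurable]: "?abs \<in> borel_measurable outcomes" "?pos \<in> borel_measurable outcomes"
    "?neg \<in> borel_measurable outcomes"
    using measurable_cumulative[OF Q] by (simp_all add: measurable_cong_sets[OF sets_outcomes refl])
  have abs: "(\<integral>\<^sup>+z. ?abs z \<partial>outcomes) < \<infinity>"
    using summable by (simp add: absolutely_summable_reward_def cumulative_def split_beta')
  have "?pos z \<le> ?abs z" "?neg z \<le> ?abs z" for z
    by (auto simp: cumulative_def intro!: suminf_le ennreal_leI)
  then have fin: "(\<integral>\<^sup>+z. ?pos z \<partial>outcomes) < \<infinity>" "(\<integral>\<^sup>+z. ?neg z \<partial>outcomes) < \<infinity>"
    by (blast intro: le_less_trans[OF nn_integral_mono abs])+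
  \<comment> \<open>Only on absolutely summable paths does the real series split into gains and
    losses; almost all paths are such.\<close>
  have "AE z in outcomes. ?abs z \<noteq> \<infinity>"
    using abs by (intro nn_integral_noteq_infinite) auto
  then have "AE z in outcomes. (case z of (w, x) \<Rightarrow> total_reward Q w x) = enn2real (?pos z) - enn2real (?neg z)"
  proof (rule AE_mp, intro AE_I2 impI)
    fix z assume finite: "?abs z \<noteq> \<infinity>"
    define f where "f = (\<lambda>t. if enat t < plays Q (fst z) (snd z) then snd z t else 0)"
    \<comment> \<open>After stopping \<open>f\<close> is 0, so \<open>g 0 = 0\<close> reproduces the
      default value 0 in \<open>cumulative\<close>.\<close>
    have cumulative_f: "cumulative g Q z = (\<Sum>t. g (f t))" if "g 0 = 0" for g
      unfolding cumulative_def f_def using that by (intro suminf_cong) simp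
    have "(case z of (w, x) \<Rightarrow> total_reward Q w x) = (\<Sum>t. f t)"
      by (simp add: total_reward_def f_def split_beta')
    also have "\<dots> = enn2real (?pos z) - enn2real (?neg z)"
      using finite suminf_eq_positive_minus_negative[of f] by (simp add: cumulative_f less_top)
    finally show "(case z of (w, x) \<Rightarrow> total_reward Q w x) = enn2real (?pos z) - enn2real (?neg z)" .
  qed
  moreover have "(\<lambda>z. case z of (w, x) \<Rightarrow> total_reward Q w x) \<in> borel_measurable outcomes"
    unfolding total_reward_def split_beta' by measurable
  ultimately have "expected_reward W prior D Q =
      enn2real (\<integral>\<^sup>+z. ?pos z \<partial>outcomes) - enn2real (\<integral>\<^sup>+z. ?neg z \<partial>outcomes)"
    unfolding expected_reward_def
    by (intro integral_eq_positive_minus_negative fin cumulative)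
  moreover have sum: "(\<integral>\<^sup>+z. ?pos z \<partial>outcomes) =
      (\<integral>\<^sup>+z. mean_reward (snd z) * mean_plays Q z \<partial>Env) + (\<integral>\<^sup>+z. ?neg z \<partial>outcomes)"
  proof -
    have [measurable]: "(\<lambda>\<theta>. \<integral>\<^sup>+r. ennreal (- r) \<partial>D \<theta>) \<in> borel_measurable prior"
      by (rule measurable_compose[OF measurable_D_subprob nn_integral_measurable_subprob_algebra]) simp
    have "(\<integral>\<^sup>+z. ?pos z \<partial>outcomes) = (\<integral>\<^sup>+z. mean_reward (snd z) * mean_plays Q z +
        (\<integral>\<^sup>+r. ennreal (- r) \<partial>D (snd z)) * mean_plays Q z \<partial>Env)"
      unfolding nn_integral_cumulative[OF Q measurable_ennreal]
      by (intro nn_integral_cong)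
        (auto simp: mean_reward_add_negative nice space_pair_measure distrib_right)
    then show ?thesis
      by (simp add: nn_integral_add nn_integral_cumulative[OF Q])
  qed
  ultimately show "(\<integral>\<^sup>+z. mean_reward (snd z) * mean_plays Q z \<partial>Env) < \<infinity>"
    and "expected_reward W prior D Q = enn2real (\<integral>\<^sup>+z. mean_reward (snd z) * mean_plays Q z \<partial>Env)"
    using fin by (auto simp: enn2real_plus less_top)
qed

section \<open>Comparing a policy with its truncation\<close>

lemma AE_truncation:
  assumes "truncation W prior D \<beta> Q Q'"
  shows "AE (w, x) in outcomes. plays Q' w x \<le> plays Q w x"
    and "AE (w, x) in outcomes. ennreal \<beta> * ennreal_of_enat (plays Q w x) \<le> ennreal_of_enat (plays Q' w x)"
proof -
  \<comment> \<open>Any time at which \<open>Q\<close> stops is not below \<open>plays Q'\<close>,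
    so \<open>plays Q'\<close> is a lower bound of the set whose infimum is
    \<open>plays Q\<close>.\<close>
  have le: "plays Q' w x \<le> plays Q w x" if "\<forall>t. enat t < plays Q' w x \<longrightarrow> Q w (history x t)" for w x
    unfolding plays_def[of Q] using that by (intro INF_greatest) (force simp: not_less[symmetric])
  show "AE (w, x) in outcomes. plays Q' w x \<le> plays Q w x"
    using assms unfolding truncation_def by (rule AE_mp) (auto intro: le)
  show "AE (w, x) in outcomes. ennreal \<beta> * ennreal_of_enat (plays Q w x) \<le> ennreal_of_enat (plays Q' w x)"
    using assms unfolding truncation_def by (rule AE_mp) auto
qed

lemma expected_plays_mono:
  assumes "AE (w, x) in outcomes. plays Q' w x \<le> plays Q w x"
  shows "expected_plays W prior D Q' \<le> expected_plays W prior D Q"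
  unfolding expected_plays_def
  by (rule nn_integral_mono_AE, rule AE_mp[OF assms]) auto

text \<open>Fewer plays drop nonnegative terms. This makes \<open>expected_reward_eq\<close>
  applicable to the truncated policy.\<close>

lemma absolutely_summable_reward_mono:
  assumes "AE (w, x) in outcomes. plays Q' w x \<le> plays Q w x"
    and "absolutely_summable_reward W prior D Q"
  shows "absolutely_summable_reward W prior D Q'"
  unfolding absolutely_summable_reward_def
proof (rule le_less_trans[OF nn_integral_mono_AE assms(2)[unfolded absolutely_summable_reward_def]])
  show "AE z in outcomes.
      (case z of (w, x) \<Rightarrow> \<Sum>t. if enat t < plays Q' w x then ennreal \<bar>x t\<bar> else 0)
      \<le> (case z of (w, x) \<Rightarrow> \<Sum>t. if enat t < plays Q w x then ennreal \<bar>x t\<bar> else 0)"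
    using assms(1)
  proof (rule AE_mp, intro AE_I2, clarify)
    fix w x assume le: "plays Q' w x \<le> plays Q w x"
    show "(\<Sum>t. if enat t < plays Q' w x then ennreal \<bar>x t\<bar> else 0)
        \<le> (\<Sum>t. if enat t < plays Q w x then ennreal \<bar>x t\<bar> else 0)"
      using le by (intro suminf_le) (auto dest: less_le_trans)
  qed
qed

text \<open>The comparison must hold given \<theta>, not just on average, because plays are weighted
  by a mean reward that varies with \<theta>. The almost sure bound passes to almost every seed and
  parameter and is then integrated over the rewards.\<close>

lemma mean_plays_mono:
  assumes "policy W Q"
    and "AE (w, x) in outcomes. c * ennreal_of_enat (plays Q w x) \<le> ennreal_of_enat (plays Q' w x)"
  shows "AE z in Env. c * mean_plays Q z \<le> mean_plays Q' z"
proof (rule AE_mp[OF AE_outcomes_D[OF assms(2)]], intro AE_I2, clarsimp simp: space_pair_measure)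
  fix w \<theta> assume w: "w \<in> space W" and \<theta>: "\<theta> \<in> space prior"
    and le: "AE x in rewards \<theta>. c * ennreal_of_enat (plays Q w x) \<le> ennreal_of_enat (plays Q' w x)"
  have sets: "sets (rewards \<theta>) = sets (\<Pi>\<^sub>M t\<in>UNIV. borel)"
    by (intro sets_PiM_cong refl sets_D \<theta>)
  have "(\<lambda>x. ennreal_of_enat (plays Q w x)) \<in> borel_measurable (\<Pi>\<^sub>M t\<in>UNIV. borel)"
    unfolding plays_eq_cumulative
    by (rule measurable_compose_Pair1[OF w measurable_cumulative[OF assms(1)]]) simp
  then have "c * mean_plays Q (w, \<theta>) = (\<integral>\<^sup>+x. c * ennreal_of_enat (plays Q w x) \<partial>rewards \<theta>)"
    unfolding mean_plays_def by (simp add: nn_integral_cmult measurable_cong_sets[OF sets refl])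
  also have "\<dots> \<le> mean_plays Q' (w, \<theta>)"
    unfolding mean_plays_def using le by (auto intro: nn_integral_mono_AE)
  finally show "c * mean_plays Q (w, \<theta>) \<le> mean_plays Q' (w, \<theta>)" .
qed

lemma truncated_reward_ge:
  assumes nice: "\<And>\<theta>. \<theta> \<in> space prior \<Longrightarrow> integrable (D \<theta>) (\<lambda>r. r)"
      "\<And>\<theta>. \<theta> \<in> space prior \<Longrightarrow> 0 \<le> (\<integral>r. r \<partial>D \<theta>)"
    and Q: "policy W Q" "absolutely_summable_reward W prior D Q"
    and Q': "policy W Q'" "truncation W prior D \<beta> Q Q'"
    and "0 \<le> \<beta>"
  shows "\<beta> * expected_reward W prior D Q \<le> expected_reward W prior D Q'"
proof -
  note [measurable] = measurable_mean_plays[OF Q(1)]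
  let ?A = "\<lambda>Q. \<integral>\<^sup>+z. mean_reward (snd z) * mean_plays Q z \<partial>Env"
  note eq = expected_reward_eq[OF nice Q]
  note eq' = expected_reward_eq[OF nice Q'(1)
      absolutely_summable_reward_mono[OF AE_truncation(1)[OF Q'(2)] Q(2)]]
  \<comment> \<open>Moving \<beta> onto the plays leaves a nonnegative weight
    \<open>mean_reward\<close>, which preserves the comparison of plays.\<close>
  have "ennreal \<beta> * ?A Q = (\<integral>\<^sup>+z. mean_reward (snd z) * (ennreal \<beta> * mean_plays Q z) \<partial>Env)"
    by (subst nn_integral_cmult[symmetric]) (auto simp: mult.left_commute intro!: nn_integral_cong)
  also have "\<dots> \<le> ?A Q'"
    using mean_plays_mono[OF Q(1) AE_truncation(2)[OF Q'(2)]]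
    by (intro nn_integral_mono_AE) (auto elim!: eventually_mono intro: mult_left_mono)
  \<comment> \<open>Finiteness of \<open>?A Q'\<close> is essential: \<open>enn2real\<close> would
    send an infinite right-hand side to 0.\<close>
  finally have "enn2real (ennreal \<beta> * ?A Q) \<le> enn2real (?A Q')"
    using eq'(1) by (intro enn2real_mono) auto
  then show ?thesis
    using \<open>0 \<le> \<beta>\<close> by (simp add: eq(2) eq'(2) enn2real_mult)
qed

end

theorem theorem1:
  fixes prior :: "'p measure"
    and D :: "'p \<Rightarrow> real measure"
    and W :: "'w measure"
    and P :: "'w state_rule"
    and P' :: "'w path_rule"
    and \<beta> :: real
  assumes "bayesian_arm prior D"
    and "\<And>\<theta>. \<theta> \<in> space prior \<Longrightarrow> integrable (D \<theta>) (\<lambda>r. r)"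
    and "\<And>\<theta>. \<theta> \<in> space prior \<Longrightarrow> 0 \<le> (\<integral>r. r \<partial>D \<theta>)"
    and "prob_space W"
    and "policy W (on_states P)"
    and "absolutely_summable_reward W prior D (on_states P)"
    and "0 \<le> \<beta>" and "\<beta> \<le> 1"
    and "policy W P'"
    and "truncation W prior D \<beta> (on_states P) P'"
  shows "\<beta> * expected_reward W prior D (on_states P) \<le> expected_reward W prior D P'
    \<and> expected_plays W prior D P' \<le> expected_plays W prior D (on_states P)"
proof -
  interpret seeded_arm W prior D
    by (intro seeded_arm.intro assms)
  show ?thesis
    using truncated_reward_ge[OF assms(2,3,5,6,9,10,7)]
      expected_plays_mono[OF AE_truncation(1)[OF assms(10)]] by blast
qed

end
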